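(* Let $\mathcal X$ be a finite alphabet, let $\mathcal M$ be a finite or countable set of probability distributions on infinite sequences over $\mathcal X$, let $\mu\in\mathcal M$, and let $\xi=\sum_{\nu\in\mathcal M}w_\nu\,\nu$ with $w_\nu>0$ for all $\nu\in\mathcal M$ and $\sum_{\nu\in\mathcal M}w_\nu=1$. Let sequences $x_1x_2\ldots$ over $\mathcal X$ be drawn with probability $\mu(x_{1:n})$ for the first $n$ symbols. A system taking action (or predicting) $y_t\in\mathcal Y$ given $x_{<t}$ receives loss $\ell_{x_ty_t}\in[0,1]$ if $x_t$ is the true $t$-th symbol of the sequence. Let $\Lambda_\xi$ and $\Lambda_\mu$ be the prediction schemes which minimize the $\xi$-expected and the $\mu$-expected loss respectively, as defined in the context. Then for every $n\ge1$ their total $\mu$-expected losses $L_n^{\Lambda_\xi}$ and $L_n^{\Lambda_\mu}$ satisfy $$0\le L_n^{\Lambda_\xi}-L_n^{\Lambda_\mu}\le D_n+\sqrt{4L_n^{\Lambda_\mu}D_n+D_n^2}\le 2D_n+2\sqrt{L_n^{\Lambda_\mu}D_n},$$ where the relative entropy $D_n$ is bounded by $\ln w_\mu^{-1}<\infty$.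
   Context: Strings: $x_{1:n}:=x_1\ldots x_n$ and $x_{<t}:=x_1\ldots x_{t-1}$. For a probability distribution $\rho$ on infinite sequences, $\rho(x_{1:t})$ is the probability that the sequence starts with $x_1\ldots x_t$, and $\rho(x_t|x_{<t}):=\rho(x_{1:t})/\rho(x_{<t})$. The mixture is $\xi(x_{1:n}):=\sum_{\nu\in\mathcal M}w_\nu\,\nu(x_{1:n})$. $\mathbf E$ denotes expectation with respect to $\mu$, and $\mathbf E_t[\cdot]:=\mathbf E[\cdot\,|\,x_{<t}]$ (only histories with $\mu(x_{<t})>0$ are considered). $\mathcal Y$ is the action (prediction) space and $\ell:\mathcal X\times\mathcal Y\to[0,1]$, $(x,y)\mapsto\ell_{xy}$, the loss function; actions do not influence the environment $\mu$. For a distribution $\rho$, the scheme $\Lambda_\rho$ chooses $$y_t^{\Lambda_\rho}:=\arg\min_{y\in\mathcal Y}\sum_{x_t\in\mathcal X}\rho(x_t|x_{<t})\,\ell_{x_ty},$$ with ties broken arbitrarily; it is assumed that a minimizer exists (automatic if $\mathcal Y$ is finite). Its instantaneous and total $\mu$-expected losses are $$l_t^{\Lambda_\rho}(x_{<t}):=\mathbf E_t\big[\ell_{x_ty_t^{\Lambda_\rho}}\big],\qquad L_n^{\Lambda_\rho}:=\sum_{t=1}^n\mathbf E\big[l_t^{\Lambda_\rho}(x_{<t})\big].$$ Relative entropy: $d_t(x_{<t}):=\sum_{x_t\in\mathcal X}\mu(x_t|x_{<t})\ln\frac{\mu(x_t|x_{<t})}{\xi(x_t|x_{<t})}$ (with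 $0\ln0:=0$) and $D_n:=\sum_{t=1}^n\mathbf E[d_t(x_{<t})]$. *)

theory Defs
  imports "HOL-Probability.Probability"
begin

definition sequence_distribution :: "'x stream measure \<Rightarrow> bool" where
  "sequence_distribution \<rho> \<longleftrightarrow>
     prob_space \<rho> \<and> sets \<rho> = sets (stream_space (count_space UNIV))"

definition string_prob :: "'x stream measure \<Rightarrow> 'x list \<Rightarrow> real" where
  "string_prob \<rho> h = measure \<rho> (sstart UNIV h)"

text \<open>
  Distributions enter the predictors only through their values on finite strings. From here on,
  \<open>\<rho>\<close> and \<open>\<xi>\<close> of type \<open>'x list \<Rightarrow> real\<close> denote such string probabilities, as the mixture
  is given on strings.
\<close>

definition mixture ::
  "'x stream measure set \<Rightarrow> ('x stream measure \<Rightarrow> real) \<Rightarrow> 'x list \<Rightarrow> real" where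
  "mixture M w h = (\<Sum>\<^sub>\<infinity>\<nu>\<in>M. w \<nu> * string_prob \<nu> h)"

text \<open>\<open>next_prob \<rho> h x\<close> is $\rho(x \mid h)$.\<close>

definition next_prob :: "('x list \<Rightarrow> real) \<Rightarrow> 'x list \<Rightarrow> 'x \<Rightarrow> real" where
  "next_prob \<rho> h x = \<rho> (h @ [x]) / \<rho> h"

text \<open>
  Expectation of \<open>f\<close> under \<open>\<mu>\<close> conditioned on the event that the sequence starts with \<open>h\<close>;
  \<open>uniform_measure \<mu> A\<close> is \<open>\<mu>\<close> conditioned on the event \<open>A\<close>.
\<close>

definition history_exp :: "'x stream measure \<Rightarrow> 'x list \<Rightarrow> ('x stream \<Rightarrow> real) \<Rightarrow> real" where
  "history_exp \<mu> h f = (LINT s | uniform_measure \<mu> (sstart UNIV h). f s)"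

text \<open>
  The scheme \<open>\<Lambda>\<close> maps the history $x_{<t}$ to the action $y_t$ and minimizes the
  \<open>\<rho>\<close>-expected loss over the action space \<open>Y\<close>. Ties may be broken in any way, so this is
  a property of \<open>\<Lambda>\<close> rather than a choice of one particular minimizer. Only histories of
  positive \<open>\<mu>\<close>-probability are constrained.
\<close>

definition minimizing_scheme ::
  "'x::finite stream measure \<Rightarrow> 'y set \<Rightarrow> ('x \<Rightarrow> 'y \<Rightarrow> real) \<Rightarrow> ('x list \<Rightarrow> real)
     \<Rightarrow> ('x list \<Rightarrow> 'y) \<Rightarrow> bool" where
  "minimizing_scheme \<mu> Y loss \<rho> \<Lambda> \<longleftrightarrow>
     (\<forall>h. string_prob \<mu> h > 0 \<longrightarrow>
        is_arg_min (\<lambda>y. \<Sum>x\<in>UNIV. next_prob \<rho> h x * loss x y) (\<lambda>y. y \<in> Y) (\<Lambda> h))"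

text \<open>
  The time index is implicit in the history: \<open>t = length h + 1\<close>. As streams are indexed
  from 0, the symbol $x_t$ following \<open>h\<close> is \<open>s !! length h\<close>.
\<close>

definition inst_loss ::
  "'x stream measure \<Rightarrow> ('x \<Rightarrow> 'y \<Rightarrow> real) \<Rightarrow> ('x list \<Rightarrow> 'y) \<Rightarrow> 'x list \<Rightarrow> real" where
  "inst_loss \<mu> loss \<Lambda> h = history_exp \<mu> h (\<lambda>s. loss (s !! length h) (\<Lambda> h))"

definition total_loss ::
  "'x stream measure \<Rightarrow> ('x \<Rightarrow> 'y \<Rightarrow> real) \<Rightarrow> ('x list \<Rightarrow> 'y) \<Rightarrow> nat \<Rightarrow> real" where
  "total_loss \<mu> loss \<Lambda> n = (\<Sum>t=1..n. LINT s | \<mu>. inst_loss \<mu> loss \<Lambda> (stake (t - 1) s))"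

text \<open>
  A summand with $\mu(x \mid h) = 0$ vanishes, in agreement with $0 \ln 0 = 0$. The junk values of
  \<open>/\<close> and \<open>ln\<close> at 0 do not matter for other summands if \<open>\<xi>\<close> is positive wherever \<open>\<mu>\<close> is,
  as for a mixture that gives \<open>\<mu>\<close> positive weight.
\<close>

definition inst_entropy ::
  "'x::finite stream measure \<Rightarrow> ('x list \<Rightarrow> real) \<Rightarrow> 'x list \<Rightarrow> real" where
  "inst_entropy \<mu> \<xi> h =
     (\<Sum>x\<in>UNIV. next_prob (string_prob \<mu>) h x
                * ln (next_prob (string_prob \<mu>) h x / next_prob \<xi> h x))"

definition total_entropy ::
  "'x::finite stream measure \<Rightarrow> ('x list \<Rightarrow> real) \<Rightarrow> nat \<Rightarrow> real" where
  "total_entropy \<mu> \<xi> n = (\<Sum>t=1..n. LINT s | \<mu>. inst_entropy \<mu> \<xi> (stake (t - 1) s))"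

end

(*
  With E = L_xi - L_mu, the main bound is equivalent to E^2 <= 2 D (L_xi + L_mu). By
  Cauchy-Schwarz over the histories of length below n, it suffices to prove
  e^2 <= 2 d (l_xi + l_mu) for each history. Let y and z be the mu- and xi-probabilities of the
  next symbol and delta in [-1, 1] the difference of the two losses. As the xi-expectation of
  delta is at most 0, the weights z (1 + c delta) have total mass at most 1 for c >= 0, so Gibbs'
  inequality gives d >= sum y ln (1 + c delta). By concavity of ln this is at least
  p ln (1 + c) + q ln (1 - c), with p and q the mu-expectations of the positive and negative parts
  of delta. For c = (p - q) / (p + q) Pinsker's inequality for two-point distributions bounds it
  below by (p - q)^2 / (2 (p + q)), where p - q = e and p + q <= l_xi + l_mu.
  The entropy D telescopes to the relative entropy of the distributions of strings of length n,
  and xi >= w_mu mu.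
*)

theory Submission
  imports Defs
begin

section \<open>Entropy bound on the loss difference for one symbol\<close>

text \<open>Gibbs' inequality against the tilted weights \<open>z i * (1 + c * d i)\<close>.
  Termwise it is \<open>ln u <= u - 1\<close>, with \<open>u\<close> the ratio of the tilted weight
  to \<open>y i\<close>. The correction terms add up to the mass of \<open>y\<close> minus the
  tilted mass, which is nonnegative.\<close>

lemma entropy_ge_tilted:
  fixes y z d :: "'a \<Rightarrow> real"
  assumes "finite I"
    and y: "\<And>i. i \<in> I \<Longrightarrow> 0 \<le> y i" and z: "\<And>i. i \<in> I \<Longrightarrow> 0 \<le> z i"
    and yz: "\<And>i. i \<in> I \<Longrightarrow> 0 < y i \<Longrightarrow> 0 < z i"
    and sum_le: "sum z I \<le> sum y I"
    and d: "\<And>i. i \<in> I \<Longrightarrow> 0 < 1 + c * d i"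
    and c: "0 \<le> c" "(\<Sum>i\<in>I. z i * d i) \<le> 0"
  shows "(\<Sum>i\<in>I. y i * ln (1 + c * d i)) \<le> (\<Sum>i\<in>I. y i * ln (y i / z i))"
proof -
  have "y i * ln (1 + c * d i) + (y i - z i - c * (z i * d i)) \<le> y i * ln (y i / z i)"
    if i: "i \<in> I" for i
  proof (cases "y i = 0")
    case True
    have "0 \<le> z i * (1 + c * d i)"
      using z[OF i] d[OF i] by simp
    then show ?thesis using True by (simp add: algebra_simps)
  next
    case False
    then have yp: "0 < y i" using y[OF i] by simp
    have zp: "0 < z i" using yz[OF i yp] .
    define u where "u = z i * (1 + c * d i) / y i"
    have up: "0 < u" unfolding u_def using yp zp d[OF i] by simp
    have "1 + c * d i = u * (y i / z i)" unfolding u_def using yp zp by simp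
    then have "ln (1 + c * d i) = ln u + ln (y i / z i)"
      using up yp zp by (simp only: ln_mult_pos divide_pos_pos)
    moreover have "ln u \<le> u - 1" by (rule ln_le_minus_one[OF up])
    ultimately have "y i * ln (1 + c * d i) \<le> y i * (u - 1 + ln (y i / z i))"
      using yp by (intro mult_left_mono) auto
    also have "\<dots> = z i * (1 + c * d i) - y i + y i * ln (y i / z i)"
      unfolding u_def using yp by (simp add: field_simps)
    finally show ?thesis by (simp add: algebra_simps)
  qed
  then have "(\<Sum>i\<in>I. y i * ln (1 + c * d i) + (y i - z i - c * (z i * d i)))
      \<le> (\<Sum>i\<in>I. y i * ln (y i / z i))"
    by (rule sum_mono)
  moreover have "(\<Sum>i\<in>I. y i * ln (1 + c * d i) + (y i - z i - c * (z i * d i)))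
    = (\<Sum>i\<in>I. y i * ln (1 + c * d i)) + (sum y I - sum z I) - c * (\<Sum>i\<in>I. z i * d i)"
    by (simp add: sum.distrib sum_subtractf sum_distrib_left)
  moreover have "c * (\<Sum>i\<in>I. z i * d i) \<le> 0"
    using c by (simp add: mult_nonneg_nonpos)
  ultimately show ?thesis using sum_le by linarith
qed

lemma entropy_nonneg:
  fixes y z :: "'a \<Rightarrow> real"
  assumes "finite I"
    and "\<And>i. i \<in> I \<Longrightarrow> 0 \<le> y i" and "\<And>i. i \<in> I \<Longrightarrow> 0 \<le> z i"
    and "\<And>i. i \<in> I \<Longrightarrow> 0 < y i \<Longrightarrow> 0 < z i"
    and "sum z I \<le> sum y I"
  shows "0 \<le> (\<Sum>i\<in>I. y i * ln (y i / z i))"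
  using entropy_ge_tilted[where c = 0 and d = "\<lambda>_. 0", OF assms] by simp

text \<open>By concavity of \<open>ln\<close>, the graph over [0, 1] lies above its chord from 0 to
  1, and the graph over [-1, 0] above its chord from -1 to 0. At 0 the logarithm vanishes, so each
  chord contributes only its other endpoint.\<close>

lemma ln_tilt_ge:
  fixes c \<delta> :: real
  assumes c: "0 \<le> c" "c < 1" and "\<delta> \<in> {-1..1}"
  shows "max \<delta> 0 * ln (1 + c) + max (- \<delta>) 0 * ln (1 - c) \<le> ln (1 + c * \<delta>)"
proof (cases "0 \<le> \<delta>")
  case True
  then have le: "ln ((1 - \<delta>) *\<^sub>R 1 + \<delta> *\<^sub>R (1 + c)) \<ge> (1 - \<delta>) * ln 1 + \<delta> * ln (1 + c)"
    using assms by (intro concave_onD[OF ln_concave]) auto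
  have "(1 - \<delta>) *\<^sub>R 1 + \<delta> *\<^sub>R (1 + c) = 1 + c * \<delta>" by (simp add: algebra_simps)
  from le[unfolded this] show ?thesis using True by simp
next
  case False
  then have le: "ln ((1 - (- \<delta>)) *\<^sub>R 1 + (- \<delta>) *\<^sub>R (1 - c)) \<ge> (1 - (- \<delta>)) * ln 1 + (- \<delta>) * ln (1 - c)"
    using assms by (intro concave_onD[OF ln_concave]) auto
  have "(1 - (- \<delta>)) *\<^sub>R 1 + (- \<delta>) *\<^sub>R (1 - c) = 1 + c * \<delta>" by (simp add: algebra_simps)
  from le[unfolded this] show ?thesis using False by simp
qed

text \<open>The right-hand side has derivative 2 / (1 - x^2), which is at least 2. This is the
  derivative estimate behind \<open>binary_pinsker\<close>.\<close>

lemma two_times_le_ln_quotient: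
  fixes t :: real
  assumes "0 \<le> t" "t < 1"
  shows "2 * t \<le> ln (1 + t) - ln (1 - t)"
proof -
  have "ln (1 + 0) - ln (1 - 0) - 2 * 0 \<le> ln (1 + t) - ln (1 - t) - 2 * t"
  proof (rule DERIV_nonneg_imp_nondecreasing[OF \<open>0 \<le> t\<close>])
    fix x :: real assume x: "0 \<le> x" "x \<le> t"
    have "((\<lambda>x. ln (1 + x) - ln (1 - x) - 2 * x) has_real_derivative
        1 / (1 + x) + 1 / (1 - x) - 2) (at x)"
      using x assms by (auto intro!: derivative_eq_intros)
    moreover have "1 / (1 + x) + 1 / (1 - x) - 2 = 2 * x\<^sup>2 / ((1 + x) * (1 - x))"
      using x assms by (simp add: divide_simps) (simp add: algebra_simps power2_eq_square)
    moreover have "2 * x\<^sup>2 / ((1 + x) * (1 - x)) \<ge> 0"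
      using x assms by simp
    ultimately show "\<exists>D. ((\<lambda>x. ln (1 + x) - ln (1 - x) - 2 * x) has_real_derivative D) (at x) \<and> 0 \<le> D"
      by metis
  qed
  then show ?thesis by simp
qed

text \<open>The right-hand side is twice the relative entropy of ((1 + t) / 2, (1 - t) / 2) with
  respect to the uniform distribution on two points. Both sides vanish at 0, and their derivatives
  compare by \<open>two_times_le_ln_quotient\<close>.\<close>

lemma binary_pinsker:
  fixes t :: real
  assumes "0 \<le> t" "t < 1"
  shows "t\<^sup>2 \<le> (1 + t) * ln (1 + t) + (1 - t) * ln (1 - t)"
proof -
  have "(1 + 0) * ln (1 + 0) + (1 - 0) * ln (1 - 0) - 0\<^sup>2
      \<le> (1 + t) * ln (1 + t) + (1 - t) * ln (1 - t) - t\<^sup>2"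
  proof (rule DERIV_nonneg_imp_nondecreasing[OF \<open>0 \<le> t\<close>])
    fix x :: real assume x: "0 \<le> x" "x \<le> t"
    have "((\<lambda>x. (1 + x) * ln (1 + x) + (1 - x) * ln (1 - x) - x\<^sup>2) has_real_derivative
        ln (1 + x) - ln (1 - x) - 2 * x) (at x)"
      using x assms by (auto intro!: derivative_eq_intros)
    then show "\<exists>D. ((\<lambda>x. (1 + x) * ln (1 + x) + (1 - x) * ln (1 - x) - x\<^sup>2) has_real_derivative D) (at x) \<and> 0 \<le> D"
      using two_times_le_ln_quotient[of x] x assms by fastforce
  qed
  then show ?thesis by simp
qed

lemma ln_tilt_optimum:
  fixes p q :: real
  assumes q: "0 \<le> q" "q \<le> p"
  obtains c where "0 \<le> c" "c < 1"
    "(p - q)\<^sup>2 \<le> 2 * (p + q) * (p * ln (1 + c) + q * ln (1 - c))"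
proof (cases "q = 0")
  \<comment> \<open>Here the maximizer of the right-hand side would be the excluded value \<open>c = 1\<close>.\<close>
  case True
  \<comment> \<open>The witness \<open>exp (1/2) - 1\<close> makes \<open>ln (1 + c)\<close> equal
    to 1/2, so that both sides of the goal are \<open>p^2\<close>. The estimate here yields
    \<open>c < 1\<close>.\<close>
  have "exp (1/2) < (2::real)"
  proof -
    have "exp (1/2 :: real) ^ 2 = exp 1" by (simp flip: exp_of_nat_mult)
    also have "\<dots> < 2 ^ 2" using exp_le by simp
    finally show ?thesis by (rule power_less_imp_less_base) simp
  qed
  then show ?thesis
    using True by (intro that[of "exp (1/2) - 1"]) (auto simp: power2_eq_square)
next
  case False
  \<comment> \<open>\<open>t\<close> is the zero of the derivative p / (1 + c) - q / (1 - c). With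
    the mean \<open>m\<close> of \<open>p\<close> and \<open>q\<close>, these are
    \<open>m * (1 + t)\<close> and \<open>m * (1 - t)\<close>, and the claim becomes
    \<open>binary_pinsker\<close> scaled by \<open>4 * m^2\<close>.\<close>
  define t where "t = (p - q) / (p + q)"
  have s: "0 < p + q" using q False by auto
  have t: "0 \<le> t" "t < 1" unfolding t_def using q False s by (auto simp: field_simps)
  define m where "m = (p + q) / 2"
  have p_eq: "p = m * (1 + t)" and q_eq: "q = m * (1 - t)"
    unfolding t_def m_def using s by (auto simp: field_simps)
  have "(p - q)\<^sup>2 = 4 * m\<^sup>2 * t\<^sup>2"
    unfolding p_eq q_eq by (simp add: power2_eq_square algebra_simps)
  also have "\<dots> \<le> 4 * m\<^sup>2 * ((1 + t) * ln (1 + t) + (1 - t) * ln (1 - t))"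
    using binary_pinsker[OF t] by (intro mult_left_mono) auto
  also have "\<dots> = 2 * (p + q) * (p * ln (1 + t) + q * ln (1 - t))"
    unfolding p_eq q_eq by (simp add: power2_eq_square algebra_simps)
  finally show ?thesis using t that by blast
qed

text \<open>The bound for a single history: \<open>a\<close> is the loss of the action that is
  better under \<open>z\<close>, and \<open>b\<close> the loss of the one that is better under
  \<open>y\<close>. Optimality under \<open>z\<close> makes the tilt by \<open>a - b\<close>
  admissible in Gibbs' inequality; optimality under \<open>y\<close> gives \<open>q <= p\<close>,
  hence a nonnegative tilt parameter.\<close>

lemma regret_sq_le_entropy:
  fixes y z a b :: "'a \<Rightarrow> real"
  assumes fin: "finite I"
    and y: "\<And>i. i \<in> I \<Longrightarrow> 0 \<le> y i" and z: "\<And>i. i \<in> I \<Longrightarrow> 0 \<le> z i"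
    and yz: "\<And>i. i \<in> I \<Longrightarrow> 0 < y i \<Longrightarrow> 0 < z i"
    and sum_le: "sum z I \<le> sum y I"
    and a: "\<And>i. i \<in> I \<Longrightarrow> a i \<in> {0..1}" and b: "\<And>i. i \<in> I \<Longrightarrow> b i \<in> {0..1}"
    and z_le: "(\<Sum>i\<in>I. z i * a i) \<le> (\<Sum>i\<in>I. z i * b i)"
    and y_le: "(\<Sum>i\<in>I. y i * b i) \<le> (\<Sum>i\<in>I. y i * a i)"
  shows "((\<Sum>i\<in>I. y i * a i) - (\<Sum>i\<in>I. y i * b i))\<^sup>2
    \<le> 2 * (\<Sum>i\<in>I. y i * ln (y i / z i)) * ((\<Sum>i\<in>I. y i * a i) + (\<Sum>i\<in>I. y i * b i))"
proof -
  let ?D = "\<Sum>i\<in>I. y i * ln (y i / z i)"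
  define d where "d i = a i - b i" for i
  define p where "p = (\<Sum>i\<in>I. y i * max (d i) 0)"
  define q where "q = (\<Sum>i\<in>I. y i * max (- d i) 0)"
  have d: "d i \<in> {-1..1}" if "i \<in> I" for i
    using a[OF that] b[OF that] by (auto simp: d_def)
  have pq: "(\<Sum>i\<in>I. y i * a i) - (\<Sum>i\<in>I. y i * b i) = p - q"
    unfolding p_def q_def sum_subtractf[symmetric]
    by (intro sum.cong) (auto simp: d_def max_def algebra_simps)
  \<comment> \<open>\<open>p + q\<close> is the \<open>y\<close>-mean of |a - b|, and |a - b| is at
    most a + b for nonnegative losses.\<close>
  have "p + q \<le> (\<Sum>i\<in>I. y i * a i) + (\<Sum>i\<in>I. y i * b i)"
    unfolding p_def q_def sum.distrib[symmetric] distrib_left[symmetric]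
    using y a b by (intro sum_mono mult_left_mono) (auto simp: d_def max_def)
  have "0 \<le> q" unfolding q_def using y by (intro sum_nonneg) auto
  then obtain c where c: "0 \<le> c" "c < 1"
    "(p - q)\<^sup>2 \<le> 2 * (p + q) * (p * ln (1 + c) + q * ln (1 - c))"
    using ln_tilt_optimum[of q p] pq y_le by auto
  have "p * ln (1 + c) + q * ln (1 - c)
      = (\<Sum>i\<in>I. y i * (max (d i) 0 * ln (1 + c) + max (- d i) 0 * ln (1 - c)))"
    unfolding p_def q_def by (simp add: sum_distrib_right sum.distrib distrib_left mult.assoc)
  also have "\<dots> \<le> (\<Sum>i\<in>I. y i * ln (1 + c * d i))"
    using y ln_tilt_ge[OF c(1,2)] d by (intro sum_mono mult_left_mono) auto
  also have "\<dots> \<le> ?D"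
  proof (rule entropy_ge_tilted[OF fin y z yz sum_le _ c(1)])
    fix i assume "i \<in> I"
    then have "c * (-1) \<le> c * d i" using c d by (intro mult_left_mono) auto
    then show "0 < 1 + c * d i" using c by simp
  next
    show "(\<Sum>i\<in>I. z i * d i) \<le> 0"
      using z_le by (simp add: d_def right_diff_distrib sum_subtractf)
  qed auto
  finally have "2 * (p + q) * (p * ln (1 + c) + q * ln (1 - c)) \<le> 2 * (p + q) * ?D"
    using \<open>0 \<le> q\<close> pq y_le by (intro mult_left_mono) auto
  also have "\<dots> \<le> 2 * ?D * ((\<Sum>i\<in>I. y i * a i) + (\<Sum>i\<in>I. y i * b i))"
    using mult_left_mono[OF \<open>p + q \<le> _\<close> entropy_nonneg[OF fin y z yz sum_le]]
    by (simp only: mult.assoc mult.left_commute mult.commute[of "p + q"]) simp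
  finally show ?thesis using c(3) unfolding pq by linarith
qed

section \<open>From measures on sequences to finite sums over strings\<close>

lemma sstart_append_UN:
  "sstart UNIV (h :: 'x list) = (\<Union>x\<in>UNIV. sstart UNIV (h @ [x]))"
proof (rule set_eqI)
  fix s :: "'x stream"
  show "s \<in> sstart UNIV h \<longleftrightarrow> s \<in> (\<Union>x\<in>UNIV. sstart UNIV (h @ [x]))"
    by (induction h arbitrary: s) auto
qed

lemma sstart_iff_stake: "s \<in> sstart UNIV h \<longleftrightarrow> stake (length h) s = h"
  by (induction h arbitrary: s) (auto simp: streams_UNIV)

text \<open>Locale form of \<open>sequence_distribution\<close>, so that the same facts serve both
  \<mu> and every other member of the class \<open>M\<close>.\<close>

locale sequence_dist = prob_space \<mu> for \<mu> :: "'x::finite stream measure" +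
  assumes sets_eq: "sets \<mu> = sets (stream_space (count_space UNIV))"
begin

lemma sstart_measurable [measurable]: "sstart UNIV h \<in> sets \<mu>"
  by (simp add: sets_eq)

lemma space_eq: "space \<mu> = UNIV"
  using sets_eq_imp_space_eq[OF sets_eq] by (simp add: space_stream_space)

lemma string_prob_nonneg: "0 \<le> string_prob \<mu> h"
  by (simp add: string_prob_def)

lemma string_prob_le_1: "string_prob \<mu> h \<le> 1"
  by (simp add: string_prob_def)

lemma string_prob_Nil: "string_prob \<mu> [] = 1"
  using prob_space by (simp add: string_prob_def space_eq)

lemma string_prob_sum_append: "(\<Sum>x\<in>UNIV. string_prob \<mu> (h @ [x])) = string_prob \<mu> h"
  unfolding string_prob_def sstart_append_UN[of h]
  by (rule finite_measure_finite_Union[symmetric])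
    (auto simp: disjoint_family_on_def sstart_iff_stake simp del: stake.simps)

lemma string_prob_append_pos: "0 < string_prob \<mu> (h @ [x]) \<Longrightarrow> 0 < string_prob \<mu> h"
  unfolding string_prob_sum_append[of h, symmetric]
  by (rule sum_pos2[of _ x]) (auto intro: string_prob_nonneg)

text \<open>Over a finite alphabet the prefix of length \<open>k\<close> takes finitely many values,
  each on its own cylinder, so the integrand is a simple function.\<close>

lemma integral_stake:
  fixes f :: "'x list \<Rightarrow> real"
  shows "(LINT s | \<mu>. f (stake k s)) = (\<Sum>h | length h = k. string_prob \<mu> h * f h)"
proof -
  have "f (stake k s) = (\<Sum>h | length h = k. f h * indicator (sstart UNIV h) s)" for s
  proof -
    have "(\<Sum>h | length h = k. f h * indicat_real (sstart UNIV h) s)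
        = (\<Sum>h | length h = k. if h = stake k s then f h else 0)"
      by (intro sum.cong) (auto simp: sstart_iff_stake)
    also have "\<dots> = f (stake k s)"
      using finite_list_length by (subst sum.delta) auto
    finally show ?thesis by simp
  qed
  then have "(LINT s | \<mu>. f (stake k s))
      = (LINT s | \<mu>. (\<Sum>h | length h = k. f h * indicator (sstart UNIV h) s))"
    by simp
  also have "\<dots> = (\<Sum>h | length h = k. f h * string_prob \<mu> h)"
    by (subst Bochner_Integration.integral_sum)
      (auto simp: string_prob_def emeasure_eq_measure)
  finally show ?thesis by (simp add: mult.commute)
qed

text \<open>Merging time and history into one index set lets a single Cauchy-Schwarz inequality
  handle both. Histories of probability 0 are dropped because the schemes are unconstrained
  there.\<close>

lemma sum_integral_stake:
  fixes f :: "'x list \<Rightarrow> real"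
  shows "(\<Sum>t=1..n. LINT s | \<mu>. f (stake (t - 1) s))
    = (\<Sum>h | length h < n \<and> 0 < string_prob \<mu> h. string_prob \<mu> h * f h)"
proof -
  have U: "{h :: 'x list. length h < n} = (\<Union>k<n. {h. length h = k})" by auto
  have "(\<Sum>t=1..n. LINT s | \<mu>. f (stake (t - 1) s)) = (\<Sum>k<n. LINT s | \<mu>. f (stake k s))"
    by (simp add: sum.atLeast1_atMost_eq)
  also have "\<dots> = (\<Sum>h | length h < n. string_prob \<mu> h * f h)"
    unfolding integral_stake U using finite_list_length by (subst sum.UNION_disjoint) auto
  also have "\<dots> = (\<Sum>h | length h < n \<and> 0 < string_prob \<mu> h. string_prob \<mu> h * f h)"
  proof (rule sum.mono_neutral_right)
    show "finite {h :: 'x list. length h < n}"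
      unfolding U using finite_list_length by auto
  qed (use string_prob_nonneg in \<open>auto simp: less_le\<close>)
  finally show ?thesis .
qed

lemma inst_loss_eq:
  assumes "0 < string_prob \<mu> h"
  shows "inst_loss \<mu> loss \<Lambda> h
    = (\<Sum>x\<in>UNIV. next_prob (string_prob \<mu>) h x * loss x (\<Lambda> h))"
proof -
  let ?A = "sstart UNIV h"
  let ?B = "\<lambda>x. {s. s !! length h = x}"
  let ?U = "uniform_measure \<mu> ?A"
  have A: "emeasure \<mu> ?A \<noteq> 0" "emeasure \<mu> ?A \<noteq> \<infinity>"
    using assms by (auto simp: string_prob_def emeasure_eq_measure)
  interpret U: prob_space ?U
    by (rule prob_space_uniform_measure[OF A])
  have B: "?B x \<in> sets \<mu>" for x
  proof -
    have "(\<lambda>s. s !! length h) \<in> measurable (stream_space (count_space UNIV)) (count_space (UNIV :: 'x set))"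
      by measurable
    from measurable_sets[OF this, of "{x}"] show ?thesis
      by (simp add: sets_eq space_stream_space vimage_def)
  qed
  \<comment> \<open>The next symbol has index \<open>length h\<close> because streams count from 0.
    This identity turns the conditional probability of \<open>x\<close> into a quotient of string
    probabilities.\<close>
  have AB: "?A \<inter> ?B x = sstart UNIV (h @ [x])" for x
    by (auto simp: sstart_iff_stake stake_Suc simp del: stake.simps)
  have "loss (s !! length h) (\<Lambda> h) = (\<Sum>x\<in>UNIV. loss x (\<Lambda> h) * indicator (?B x) s)" for s
  proof -
    have "(\<Sum>x\<in>UNIV. loss x (\<Lambda> h) * indicator (?B x) s)
        = (\<Sum>x\<in>UNIV. if x = s !! length h then loss x (\<Lambda> h) else 0)"
      by (intro sum.cong) auto
    then show ?thesis by simp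
  qed
  then have "inst_loss \<mu> loss \<Lambda> h
      = (LINT s | ?U. (\<Sum>x\<in>UNIV. loss x (\<Lambda> h) * indicator (?B x) s))"
    unfolding inst_loss_def history_exp_def by simp
  also have "\<dots> = (\<Sum>x\<in>UNIV. loss x (\<Lambda> h) * measure ?U (?B x))"
    using B by (subst Bochner_Integration.integral_sum)
      (auto simp: U.emeasure_eq_measure space_eq simp del: measure_uniform_measure)
  also have "\<dots> = (\<Sum>x\<in>UNIV. next_prob (string_prob \<mu>) h x * loss x (\<Lambda> h))"
    by (simp add: measure_uniform_measure[OF A B] AB next_prob_def string_prob_def mult.commute)
  finally show ?thesis .
qed

lemma sum_next_prob:
  assumes "0 < string_prob \<mu> h"
  shows "(\<Sum>x\<in>UNIV. next_prob (string_prob \<mu>) h x) = 1"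
  using assms string_prob_sum_append[of h]
  by (simp add: next_prob_def flip: sum_divide_distrib)

text \<open>The chain rule of relative entropy: the log-ratio of conditional probabilities is a
  difference of log-ratios of string probabilities, so the expected entropies telescope. The
  hypothesis on the empty string makes the initial term vanish.\<close>

lemma total_entropy_eq:
  assumes pos: "\<And>h. 0 < string_prob \<mu> h \<Longrightarrow> 0 < \<xi> h" and Nil: "\<xi> [] = 1"
  shows "total_entropy \<mu> \<xi> n
    = (\<Sum>h | length h = n. string_prob \<mu> h * ln (string_prob \<mu> h / \<xi> h))"
proof -
  define G where "G k = (\<Sum>h | length h = k. string_prob \<mu> h * ln (string_prob \<mu> h / \<xi> h))" for k
  have step: "string_prob \<mu> h * inst_entropy \<mu> \<xi> h
      = (\<Sum>x\<in>UNIV. string_prob \<mu> (h @ [x]) * ln (string_prob \<mu> (h @ [x]) / \<xi> (h @ [x])))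
        - string_prob \<mu> h * ln (string_prob \<mu> h / \<xi> h)" for h
  proof (cases "string_prob \<mu> h = 0")
    \<comment> \<open>All extensions of a null history are null, so both sides vanish, whatever
      value \<open>inst_entropy\<close> takes there.\<close>
    case True
    then have "string_prob \<mu> (h @ [x]) = 0" for x
      using string_prob_append_pos[of h x] string_prob_nonneg[of "h @ [x]"] by force
    then show ?thesis using True by simp
  next
    case False
    then have h: "0 < string_prob \<mu> h" using string_prob_nonneg[of h] by simp
    have "string_prob \<mu> h * (next_prob (string_prob \<mu>) h x
          * ln (next_prob (string_prob \<mu>) h x / next_prob \<xi> h x))
        = string_prob \<mu> (h @ [x]) * ln (string_prob \<mu> (h @ [x]) / \<xi> (h @ [x]))
          - string_prob \<mu> (h @ [x]) * ln (string_prob \<mu> h / \<xi> h)" for x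
    proof (cases "string_prob \<mu> (h @ [x]) = 0")
      case True
      then show ?thesis by (simp add: next_prob_def)
    next
      case False
      then have x: "0 < string_prob \<mu> (h @ [x])" using string_prob_nonneg[of "h @ [x]"] by simp
      have "ln (next_prob (string_prob \<mu>) h x / next_prob \<xi> h x)
          = ln ((string_prob \<mu> (h @ [x]) / \<xi> (h @ [x])) / (string_prob \<mu> h / \<xi> h))"
        by (simp add: next_prob_def mult.commute)
      also have "\<dots> = ln (string_prob \<mu> (h @ [x]) / \<xi> (h @ [x])) - ln (string_prob \<mu> h / \<xi> h)"
        using h x by (intro ln_divide_pos divide_pos_pos pos)
      finally show ?thesis using h by (simp add: next_prob_def right_diff_distrib)
    qed
    then show ?thesis
      unfolding inst_entropy_def sum_distrib_left
      by (simp add: sum_subtractf string_prob_sum_append flip: sum_distrib_right)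
  qed
  have "(\<Sum>h | length h = k. \<Sum>x\<in>UNIV. string_prob \<mu> (h @ [x]) * ln (string_prob \<mu> (h @ [x]) / \<xi> (h @ [x])))
      = G (Suc k)" for k
    unfolding G_def sum.cartesian_product
  \<comment> \<open>Strings of length \<open>Suc k\<close> correspond to pairs of a prefix of length
    \<open>k\<close> and a last symbol.\<close>
  proof (rule sum.reindex_bij_witness[of _ "\<lambda>h. (butlast h, last h)" "\<lambda>(h, x). h @ [x]"])
    fix h :: "'x list" assume "h \<in> {h. length h = Suc k}"
    then have "h \<noteq> []" by auto
    then show "(case (butlast h, last h) of (h, x) \<Rightarrow> h @ [x]) = h" by simp
  qed auto
  then have "(LINT s | \<mu>. inst_entropy \<mu> \<xi> (stake k s)) = G (Suc k) - G k" for k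
    unfolding integral_stake step sum_subtractf by (simp add: G_def)
  then have "total_entropy \<mu> \<xi> n = (\<Sum>k<n. G (Suc k) - G k)"
    by (simp add: total_entropy_def sum.atLeast1_atMost_eq)
  also have "\<dots> = G n - G 0" by (rule sum_lessThan_telescope)
  also have "G 0 = 0" by (simp add: G_def string_prob_Nil Nil)
  finally show ?thesis by (simp add: G_def)
qed

end

lemma sequence_dist_iff: "sequence_dist \<mu> \<longleftrightarrow> sequence_distribution \<mu>"
  by (simp add: sequence_dist_def sequence_dist_axioms_def sequence_distribution_def)

section \<open>The mixture as a function on strings\<close>

lemma has_sum_finite_sum:
  fixes f :: "'a \<Rightarrow> 'b \<Rightarrow> real"
  assumes "finite X" and "\<And>x. x \<in> X \<Longrightarrow> (f x has_sum S x) A"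
  shows "((\<lambda>a. \<Sum>x\<in>X. f x a) has_sum (\<Sum>x\<in>X. S x)) A"
  using assms by (induction X rule: finite_induct) (auto intro!: has_sum_add)

text \<open>The terms are dominated by the weights. As a non-summable family would have infinite sum
  0 by default, the lower bound and the additivity of \<open>mixture\<close> rest on this.\<close>

lemma mixture_summable:
  fixes M :: "'x::finite stream measure set"
  assumes "\<And>\<nu>. \<nu> \<in> M \<Longrightarrow> sequence_distribution \<nu>"
    and "\<And>\<nu>. \<nu> \<in> M \<Longrightarrow> w \<nu> > 0"
    and "(w has_sum 1) M"
  shows "(\<lambda>\<nu>. w \<nu> * string_prob \<nu> h) summable_on M"
proof (rule summable_on_comparison_test)
  show "w summable_on M" using assms(3) by (auto simp: summable_on_def)
next
  fix \<nu> assume \<nu>: "\<nu> \<in> M"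
  then interpret sequence_dist \<nu> using assms(1) by (simp add: sequence_dist_iff)
  show "w \<nu> * string_prob \<nu> h \<le> w \<nu>"
    using assms(2)[OF \<nu>] string_prob_le_1 by (simp add: mult_le_cancel_left1)
  show "0 \<le> w \<nu> * string_prob \<nu> h"
    using assms(2)[OF \<nu>] string_prob_nonneg by simp
qed

text \<open>All terms but that of \<mu> are discarded. This dominance yields both the positivity of
  \<xi> wherever \<mu> is positive and the final bound on the entropy.\<close>

lemma mixture_ge:
  fixes M :: "'x::finite stream measure set"
  assumes "\<And>\<nu>. \<nu> \<in> M \<Longrightarrow> sequence_distribution \<nu>"
    and "\<And>\<nu>. \<nu> \<in> M \<Longrightarrow> w \<nu> > 0"
    and "(w has_sum 1) M" and "\<mu> \<in> M"
  shows "w \<mu> * string_prob \<mu> h \<le> mixture M w h"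
proof -
  have "(\<Sum>\<nu>\<in>{\<mu>}. w \<nu> * string_prob \<nu> h) \<le> mixture M w h"
    unfolding mixture_def
    using assms(2,4) mixture_summable[OF assms(1-3)]
    by (intro finite_sum_le_infsum) (auto simp: string_prob_def less_imp_le)
  then show ?thesis by simp
qed

lemma mixture_nonneg:
  assumes "\<And>\<nu>. \<nu> \<in> M \<Longrightarrow> w \<nu> > 0"
  shows "0 \<le> mixture M w h"
  unfolding mixture_def using assms
  by (intro infsum_nonneg) (auto simp: string_prob_def less_imp_le)

lemma mixture_sum_append:
  fixes M :: "'x::finite stream measure set"
  assumes "\<And>\<nu>. \<nu> \<in> M \<Longrightarrow> sequence_distribution \<nu>"
    and "\<And>\<nu>. \<nu> \<in> M \<Longrightarrow> w \<nu> > 0"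
    and "(w has_sum 1) M"
  shows "(\<Sum>x\<in>UNIV. mixture M w (h @ [x])) = mixture M w h"
proof -
  have "(\<Sum>x\<in>UNIV. mixture M w (h @ [x]))
      = (\<Sum>\<^sub>\<infinity>\<nu>\<in>M. \<Sum>x\<in>UNIV. w \<nu> * string_prob \<nu> (h @ [x]))"
    unfolding mixture_def
    by (intro infsumI[symmetric] has_sum_finite_sum has_sum_infsum mixture_summable[OF assms])
      simp_all
  also have "\<dots> = mixture M w h"
    unfolding mixture_def using assms(1)
    by (intro infsum_cong)
      (auto simp: sequence_dist.string_prob_sum_append sequence_dist_iff simp flip: sum_distrib_left)
  finally show ?thesis .
qed

lemma mixture_Nil:
  fixes M :: "'x::finite stream measure set"
  assumes "\<And>\<nu>. \<nu> \<in> M \<Longrightarrow> sequence_distribution \<nu>" and "(w has_sum 1) M"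
  shows "mixture M w [] = 1"
proof -
  have "mixture M w [] = infsum w M"
    unfolding mixture_def using assms(1)
    by (intro infsum_cong) (simp add: sequence_dist.string_prob_Nil sequence_dist_iff)
  then show ?thesis using infsumI[OF assms(2)] by simp
qed

section \<open>Summation over histories and the total loss bounds\<close>

text \<open>Carries the bound for single histories over to expectations: Cauchy-Schwarz for the
  vectors with entries \<open>sqrt (u i * d i)\<close> and \<open>sqrt (u i * s i)\<close>.\<close>

lemma sq_sum_weighted_le:
  fixes u e d s :: "'a \<Rightarrow> real"
  assumes u: "\<And>i. i \<in> I \<Longrightarrow> 0 \<le> u i" and e: "\<And>i. i \<in> I \<Longrightarrow> 0 \<le> e i"
    and d: "\<And>i. i \<in> I \<Longrightarrow> 0 \<le> d i" and s: "\<And>i. i \<in> I \<Longrightarrow> 0 \<le> s i"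
    and le: "\<And>i. i \<in> I \<Longrightarrow> (e i)\<^sup>2 \<le> d i * s i"
  shows "(\<Sum>i\<in>I. u i * e i)\<^sup>2 \<le> (\<Sum>i\<in>I. u i * d i) * (\<Sum>i\<in>I. u i * s i)"
proof -
  have "u i * e i \<le> sqrt (u i * d i) * sqrt (u i * s i)" if "i \<in> I" for i
  proof -
    have "u i * e i \<le> u i * sqrt (d i * s i)"
      using that by (intro mult_left_mono real_le_rsqrt le u)
    also have "\<dots> = sqrt (u i * d i) * sqrt (u i * s i)"
      using u[OF that] by (simp add: real_sqrt_mult)
    finally show ?thesis .
  qed
  then have "(\<Sum>i\<in>I. u i * e i)\<^sup>2 \<le> (\<Sum>i\<in>I. sqrt (u i * d i) * sqrt (u i * s i))\<^sup>2"
    using u e by (intro power_mono sum_mono sum_nonneg) auto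
  also have "\<dots> \<le> (\<Sum>i\<in>I. (sqrt (u i * d i))\<^sup>2) * (\<Sum>i\<in>I. (sqrt (u i * s i))\<^sup>2)"
    by (rule Cauchy_Schwarz_ineq_sum)
  also have "\<dots> = (\<Sum>i\<in>I. u i * d i) * (\<Sum>i\<in>I. u i * s i)"
    using u d s by simp
  finally show ?thesis .
qed

theorem theorem2:
  fixes M :: "'x::finite stream measure set"
    and w :: "'x stream measure \<Rightarrow> real"
    and \<mu> :: "'x stream measure"
    and Y :: "'y set"
    and loss :: "'x \<Rightarrow> 'y \<Rightarrow> real"
    and \<Lambda>\<^sub>\<xi> \<Lambda>\<^sub>\<mu> :: "'x list \<Rightarrow> 'y"
    and n :: nat
  defines "\<xi> \<equiv> mixture M w"
  defines "L\<^sub>\<xi> \<equiv> total_loss \<mu> loss \<Lambda>\<^sub>\<xi> n"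
    and "L\<^sub>\<mu> \<equiv> total_loss \<mu> loss \<Lambda>\<^sub>\<mu> n"
    and "D \<equiv> total_entropy \<mu> \<xi> n"
  assumes "countable M"
    and "\<And>\<nu>. \<nu> \<in> M \<Longrightarrow> sequence_distribution \<nu>"
    and "\<mu> \<in> M"
    and "\<And>\<nu>. \<nu> \<in> M \<Longrightarrow> w \<nu> > 0"
    and "(w has_sum 1) M"
    and "\<And>x y. y \<in> Y \<Longrightarrow> loss x y \<in> {0..1}"
    and "minimizing_scheme \<mu> Y loss \<xi> \<Lambda>\<^sub>\<xi>"
    and "minimizing_scheme \<mu> Y loss (string_prob \<mu>) \<Lambda>\<^sub>\<mu>"
    and "n \<ge> 1"
  shows "0 \<le> L\<^sub>\<xi> - L\<^sub>\<mu>
    \<and> L\<^sub>\<xi> - L\<^sub>\<mu> \<le> D + sqrt (4 * L\<^sub>\<mu> * D + D\<^sup>2)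
    \<and> D + sqrt (4 * L\<^sub>\<mu> * D + D\<^sup>2) \<le> 2 * D + 2 * sqrt (L\<^sub>\<mu> * D)
    \<and> D \<le> ln (inverse (w \<mu>))"
proof -
  interpret sequence_dist \<mu> using assms by (simp add: sequence_dist_iff)
  let ?p = "string_prob \<mu>"
  let ?H = "{h. length h < n \<and> 0 < ?p h}"
  let ?l = "inst_loss \<mu> loss"
  let ?d = "inst_entropy \<mu> \<xi>"
  have w: "0 < w \<mu>" using assms by simp
  have \<xi>_ge: "w \<mu> * ?p h \<le> \<xi> h" for h
    unfolding \<xi>_def using mixture_ge assms by blast
  then have \<xi>_pos: "0 < \<xi> h" if "0 < ?p h" for h
    using mult_pos_pos[OF w that] by (rule less_le_trans[rotated])
  have \<xi>_nonneg: "0 \<le> \<xi> h" for h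
    unfolding \<xi>_def using mixture_nonneg assms by blast
  have \<xi>_sum: "(\<Sum>x\<in>UNIV. \<xi> (h @ [x])) = \<xi> h" for h
    unfolding \<xi>_def using mixture_sum_append assms by blast
  have \<xi>_Nil: "\<xi> [] = 1"
    unfolding \<xi>_def using mixture_Nil assms by blast

  have inst: "0 \<le> ?d h" "0 \<le> ?l \<Lambda>\<^sub>\<mu> h" "?l \<Lambda>\<^sub>\<mu> h \<le> ?l \<Lambda>\<^sub>\<xi> h"
      "(?l \<Lambda>\<^sub>\<xi> h - ?l \<Lambda>\<^sub>\<mu> h)\<^sup>2 \<le> 2 * ?d h * (?l \<Lambda>\<^sub>\<xi> h + ?l \<Lambda>\<^sub>\<mu> h)" if h: "0 < ?p h" for h
  proof -
    have Y: "\<Lambda>\<^sub>\<xi> h \<in> Y" "\<Lambda>\<^sub>\<mu> h \<in> Y"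
      and min_\<xi>: "(\<Sum>x\<in>UNIV. next_prob \<xi> h x * loss x (\<Lambda>\<^sub>\<xi> h))
        \<le> (\<Sum>x\<in>UNIV. next_prob \<xi> h x * loss x (\<Lambda>\<^sub>\<mu> h))"
      and min_\<mu>: "(\<Sum>x\<in>UNIV. next_prob ?p h x * loss x (\<Lambda>\<^sub>\<mu> h))
        \<le> (\<Sum>x\<in>UNIV. next_prob ?p h x * loss x (\<Lambda>\<^sub>\<xi> h))"
      using assms(11,12) h by (auto simp: minimizing_scheme_def is_arg_min_def not_less)
    have y: "0 \<le> next_prob ?p h x" for x
      by (simp add: next_prob_def string_prob_nonneg)
    have z: "0 \<le> next_prob \<xi> h x" for x
      by (simp add: next_prob_def \<xi>_nonneg)
    have yz: "0 < next_prob \<xi> h x" if "0 < next_prob ?p h x" for x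
      using that \<xi>_pos h by (simp add: next_prob_def zero_less_divide_iff)
    have "(\<Sum>x\<in>UNIV. next_prob \<xi> h x) = 1"
      using \<xi>_pos[OF h] \<xi>_sum[of h] by (simp add: next_prob_def flip: sum_divide_distrib)
    then have le: "(\<Sum>x\<in>UNIV. next_prob \<xi> h x) \<le> (\<Sum>x\<in>UNIV. next_prob ?p h x)"
      using sum_next_prob[OF h] by simp
    show "0 \<le> ?d h"
      unfolding inst_entropy_def by (rule entropy_nonneg) (use y z yz le in auto)
    show "0 \<le> ?l \<Lambda>\<^sub>\<mu> h"
      unfolding inst_loss_eq[OF h] using y assms(10)[OF Y(2)] by (intro sum_nonneg) auto
    show "?l \<Lambda>\<^sub>\<mu> h \<le> ?l \<Lambda>\<^sub>\<xi> h"
      unfolding inst_loss_eq[OF h] by (rule min_\<mu>)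
    show "(?l \<Lambda>\<^sub>\<xi> h - ?l \<Lambda>\<^sub>\<mu> h)\<^sup>2 \<le> 2 * ?d h * (?l \<Lambda>\<^sub>\<xi> h + ?l \<Lambda>\<^sub>\<mu> h)"
      unfolding inst_loss_eq[OF h] inst_entropy_def
      by (rule regret_sq_le_entropy)
        (use y z yz le min_\<xi> min_\<mu> assms(10)[OF Y(1)] assms(10)[OF Y(2)] in auto)
  qed

  have L\<^sub>\<xi>: "L\<^sub>\<xi> = (\<Sum>h\<in>?H. ?p h * ?l \<Lambda>\<^sub>\<xi> h)"
    and L\<^sub>\<mu>: "L\<^sub>\<mu> = (\<Sum>h\<in>?H. ?p h * ?l \<Lambda>\<^sub>\<mu> h)"
    and D: "D = (\<Sum>h\<in>?H. ?p h * ?d h)"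
    unfolding L\<^sub>\<xi>_def L\<^sub>\<mu>_def D_def total_loss_def total_entropy_def
    by (rule sum_integral_stake)+
  have L_nonneg: "0 \<le> L\<^sub>\<mu>" and D_nonneg: "0 \<le> D" and L_le: "L\<^sub>\<mu> \<le> L\<^sub>\<xi>"
    unfolding L\<^sub>\<xi> L\<^sub>\<mu> D using inst by (auto intro!: sum_nonneg sum_mono)
  \<comment> \<open>The weights are the history probabilities, and the factor 2 is absorbed into the
    entropy.\<close>
  have "(\<Sum>h\<in>?H. ?p h * (?l \<Lambda>\<^sub>\<xi> h - ?l \<Lambda>\<^sub>\<mu> h))\<^sup>2
      \<le> (\<Sum>h\<in>?H. ?p h * (2 * ?d h)) * (\<Sum>h\<in>?H. ?p h * (?l \<Lambda>\<^sub>\<xi> h + ?l \<Lambda>\<^sub>\<mu> h))"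
    using inst by (intro sq_sum_weighted_le) (auto intro: add_nonneg_nonneg order_trans[OF inst(2) inst(3)])
  then have "(L\<^sub>\<xi> - L\<^sub>\<mu>)\<^sup>2 \<le> 2 * D * (L\<^sub>\<xi> + L\<^sub>\<mu>)"
    unfolding L\<^sub>\<xi> L\<^sub>\<mu> D
    by (simp add: right_diff_distrib distrib_left sum_subtractf sum.distrib sum_distrib_left mult_ac)
  \<comment> \<open>Completing the square: with E the loss difference, the sum of the two losses is
    E + 2 \<open>L\<^sub>\<mu>\<close>, so E^2 - 2 D E is at most 4 \<open>L\<^sub>\<mu>\<close>
    D.\<close>
  then have "((L\<^sub>\<xi> - L\<^sub>\<mu>) - D)\<^sup>2 \<le> 4 * L\<^sub>\<mu> * D + D\<^sup>2"
    by (simp add: power2_eq_square algebra_simps)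
  then have "L\<^sub>\<xi> - L\<^sub>\<mu> \<le> D + sqrt (4 * L\<^sub>\<mu> * D + D\<^sup>2)"
    using real_le_rsqrt by fastforce
  moreover have "sqrt (4 * L\<^sub>\<mu> * D + D\<^sup>2) \<le> sqrt (4 * L\<^sub>\<mu> * D) + sqrt (D\<^sup>2)"
    using L_nonneg D_nonneg by (intro sqrt_add_le_add_sqrt) auto
  then have "D + sqrt (4 * L\<^sub>\<mu> * D + D\<^sup>2) \<le> 2 * D + 2 * sqrt (L\<^sub>\<mu> * D)"
    using D_nonneg by (simp add: real_sqrt_mult)
  moreover have "D \<le> ln (inverse (w \<mu>))"
  proof -
    \<comment> \<open>After telescoping, dominance bounds each log-ratio by the same constant, and
      the string probabilities of length \<open>n\<close> sum to 1.\<close>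
    have "D = (\<Sum>h | length h = n. ?p h * ln (?p h / \<xi> h))"
      unfolding D_def using \<xi>_pos \<xi>_Nil by (rule total_entropy_eq)
    also have "\<dots> \<le> (\<Sum>h | length h = n. ?p h * ln (inverse (w \<mu>)))"
    proof (rule sum_mono)
      fix h
      show "?p h * ln (?p h / \<xi> h) \<le> ?p h * ln (inverse (w \<mu>))"
      proof (cases "?p h = 0")
        case False
        then have h: "0 < ?p h" using string_prob_nonneg[of h] by simp
        have "?p h / \<xi> h \<le> inverse (w \<mu>)"
          using \<xi>_ge[of h] \<xi>_pos[OF h] w by (simp add: field_simps)
        then show ?thesis
          using h \<xi>_pos[OF h] by (intro mult_left_mono ln_mono) auto
      qed simp
    qed
    also have "\<dots> = ln (inverse (w \<mu>))"
      using integral_stake[of "\<lambda>_. ln (inverse (w \<mu>))" n] prob_space by simp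
    finally show ?thesis .
  qed
  ultimately show ?thesis using L_le by simp
qed

end
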